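(* Let $\mathcal{C}$ be a closed symmetric monoidal category and let $\mathcal{T}$ be a one-object category enriched over $\mathcal{C}$, with hom-object $T$, composition $\mu:T\otimes T\to T$ and unit $\iota:1_{\mathcal{C}}\to T$, and suppose that $(T,\mu,\iota)$ is a commutative monoid. Let $\Phi:T\otimes\Omega\to\Omega$ be a left action of $T$ on an object $\Omega$ of $\mathcal{C}$, with adjoint $\Phi^\flat:\Omega\to[T;\Omega]$, and let $q:E_\Phi\to[T;\Omega]$ denote the equalizer of $\mathrm{shift}_\Omega^\flat,\ \mathrm{Tr}_\Phi^\flat:[T;\Omega]\to[T;[T;\Omega]]$. Then $\Phi^\flat$ coincides with the equalizer $q$, i.e. $\Phi^\flat:\Omega\to[T;\Omega]$ is itself an equalizer of $\mathrm{shift}_\Omega^\flat$ and $\mathrm{Tr}_\Phi^\flat$. Consequently the subshift domain $E_\Phi$ is isomorphic to $\Omega$.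
   Context: Time: the time semigroup $\mathcal{T}$ (with identity) is viewed as a one-object category enriched over $\mathcal{C}$; $(T,\mu,\iota)$ is then a monoid object in $\mathcal{C}$. It is commutative if $\mu\circ\mathrm{swap}_{T,T}=\mu$, where $\mathrm{swap}$ is the symmetry of $\mathcal{C}$. Associators are suppressed. Internal homs: $[y;z]$ is the internal hom, with $\mathrm{Hom}(y\otimes x;z)\cong\mathrm{Hom}(x;[y;z])$ and evaluation $\mathrm{eval}:y\otimes[y;z]\to z$. For a morphism $F:T\otimes X\to X$, $F^\flat:X\to[T;X]$ is its adjoint under this bijection. Left action: $\Psi:T\otimes X\to X$ is a left action of $T$ if $\Psi\circ(\iota\otimes X)$ is the canonical isomorphism $1_{\mathcal{C}}\otimes X\cong X$ and $\Psi\circ(T\otimes\Psi)=\Psi\circ(\mu\otimes X)$. Shift: $\mathrm{shift}_\Omega:T\otimes[T;\Omega]\to[T;\Omega]$ is the adjoint, with respect to the first (leftmost) factor $T$, of $T\otimes T\otimes[T;\Omega]\xrightarrow{\mu\otimes[T;\Omega]}T\otimes[T;\Omega]\xrightarrow{\mathrm{eval}}\Omega$. Transfer operator: $\mathrm{Tr}_\Phi:T\otimes[T;\Omega]\to[T;\Omega]$ is the adjoint, with respect to the first (leftmost) factor $T$, of $T\otimes T\otimes[T;\Omega]\xrightarrow{\mathrm{swap}_{T,T}\otimes[T;\Omega]}T\otimes T\otimes[T;\Omega]\xrightarrow{T\otimes\mathrm{eval}}T\otimes\Omega\xrightarrow{\Phi}\Omega$. *)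

theory Defs
  imports Main
begin

section \<open>Closed symmetric monoidal categories\<close>

record ('o, 'a) category =
  Obj :: "'o set"
  Arr :: "'a set"
  Dom :: "'a \<Rightarrow> 'o"
  Cod :: "'a \<Rightarrow> 'o"
  Id :: "'o \<Rightarrow> 'a"
  Comp :: "'a \<Rightarrow> 'a \<Rightarrow> 'a" (infixr \<open>\<cdot>\<index>\<close> 65)

definition Hom :: "('o, 'a, 'z) category_scheme \<Rightarrow> 'o \<Rightarrow> 'o \<Rightarrow> 'a set" where
  "Hom C a b = {f \<in> Arr C. Dom C f = a \<and> Cod C f = b}"

text \<open>\<open>g \<cdot> f\<close> is "g after f"; its value is unspecified unless \<open>Cod f = Dom g\<close>.\<close>

locale category =
  fixes C :: "('o, 'a, 'z) category_scheme" (structure)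
  assumes Dom_Obj: "f \<in> Arr C \<Longrightarrow> Dom C f \<in> Obj C"
    and Cod_Obj: "f \<in> Arr C \<Longrightarrow> Cod C f \<in> Obj C"
    and Id_Hom: "a \<in> Obj C \<Longrightarrow> Id C a \<in> Hom C a a"
    and Comp_Hom: "\<lbrakk>f \<in> Hom C a b; g \<in> Hom C b c\<rbrakk> \<Longrightarrow> g \<cdot> f \<in> Hom C a c"
    and Comp_Id: "f \<in> Hom C a b \<Longrightarrow> f \<cdot> Id C a = f"
    and Id_Comp: "f \<in> Hom C a b \<Longrightarrow> Id C b \<cdot> f = f"
    and Comp_assoc: "\<lbrakk>f \<in> Hom C a b; g \<in> Hom C b c; h \<in> Hom C c d\<rbrakk>
          \<Longrightarrow> (h \<cdot> g) \<cdot> f = h \<cdot> (g \<cdot> f)"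

definition inverse_arrows ::
    "('o, 'a, 'z) category_scheme \<Rightarrow> 'o \<Rightarrow> 'o \<Rightarrow> 'a \<Rightarrow> 'a \<Rightarrow> bool" where
  "inverse_arrows C a b f g \<longleftrightarrow> f \<in> Hom C a b \<and> g \<in> Hom C b a \<and>
     g \<cdot>\<^bsub>C\<^esub> f = Id C a \<and> f \<cdot>\<^bsub>C\<^esub> g = Id C b"

definition iso_arrow :: "('o, 'a, 'z) category_scheme \<Rightarrow> 'o \<Rightarrow> 'o \<Rightarrow> 'a \<Rightarrow> bool" where
  "iso_arrow C a b f \<longleftrightarrow> (\<exists>g. inverse_arrows C a b f g)"

definition isomorphic_objects :: "('o, 'a, 'z) category_scheme \<Rightarrow> 'o \<Rightarrow> 'o \<Rightarrow> bool" where
  "isomorphic_objects C a b \<longleftrightarrow> (\<exists>f. iso_arrow C a b f)"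

definition Inv :: "('o, 'a, 'z) category_scheme \<Rightarrow> 'a \<Rightarrow> 'a" where
  "Inv C f = (THE g. inverse_arrows C (Dom C f) (Cod C f) f g)"

definition is_equalizer ::
    "('o, 'a, 'z) category_scheme \<Rightarrow> 'o \<Rightarrow> 'o \<Rightarrow> 'o \<Rightarrow> 'a \<Rightarrow> 'a \<Rightarrow> 'a \<Rightarrow> bool" where
  "is_equalizer C E A B e f g \<longleftrightarrow>
     e \<in> Hom C E A \<and> f \<in> Hom C A B \<and> g \<in> Hom C A B \<and> f \<cdot>\<^bsub>C\<^esub> e = g \<cdot>\<^bsub>C\<^esub> e \<and>
     (\<forall>X h. h \<in> Hom C X A \<and> f \<cdot>\<^bsub>C\<^esub> h = g \<cdot>\<^bsub>C\<^esub> h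
        \<longrightarrow> (\<exists>!k. k \<in> Hom C X E \<and> e \<cdot>\<^bsub>C\<^esub> k = h))"

text \<open>\<open>\<otimes>\<close> is the tensor product on objects, \<open>\<odot>\<close> the tensor product on arrows.\<close>

record ('o, 'a) monoidal_category = "('o, 'a) category" +
  Tensor :: "'o \<Rightarrow> 'o \<Rightarrow> 'o" (infixr \<open>\<otimes>\<index>\<close> 70)
  TensorArr :: "'a \<Rightarrow> 'a \<Rightarrow> 'a" (infixr \<open>\<odot>\<index>\<close> 70)
  Unit :: "'o" (\<open>\<one>\<index>\<close>)
  Assoc :: "'o \<Rightarrow> 'o \<Rightarrow> 'o \<Rightarrow> 'a"
  LUnit :: "'o \<Rightarrow> 'a"
  RUnit :: "'o \<Rightarrow> 'a"

locale monoidal_category = category C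
  for C :: "('o, 'a, 'z) monoidal_category_scheme" (structure) +
  assumes Unit_Obj: "\<one> \<in> Obj C"
    and Tensor_Obj: "\<lbrakk>a \<in> Obj C; b \<in> Obj C\<rbrakk> \<Longrightarrow> a \<otimes> b \<in> Obj C"
    and TensorArr_Hom: "\<lbrakk>f \<in> Hom C a b; g \<in> Hom C c d\<rbrakk> \<Longrightarrow> f \<odot> g \<in> Hom C (a \<otimes> c) (b \<otimes> d)"
    and TensorArr_Id: "\<lbrakk>a \<in> Obj C; b \<in> Obj C\<rbrakk> \<Longrightarrow> Id C a \<odot> Id C b = Id C (a \<otimes> b)"
    and TensorArr_Comp:
      "\<lbrakk>f \<in> Hom C a b; f' \<in> Hom C b c; g \<in> Hom C a' b'; g' \<in> Hom C b' c'\<rbrakk>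
        \<Longrightarrow> (f' \<cdot> f) \<odot> (g' \<cdot> g) = (f' \<odot> g') \<cdot> (f \<odot> g)"
    and Assoc_iso: "\<lbrakk>a \<in> Obj C; b \<in> Obj C; c \<in> Obj C\<rbrakk>
        \<Longrightarrow> iso_arrow C ((a \<otimes> b) \<otimes> c) (a \<otimes> (b \<otimes> c)) (Assoc C a b c)"
    and Assoc_natural:
      "\<lbrakk>f \<in> Hom C a a'; g \<in> Hom C b b'; h \<in> Hom C c c'\<rbrakk>
        \<Longrightarrow> Assoc C a' b' c' \<cdot> ((f \<odot> g) \<odot> h) = (f \<odot> (g \<odot> h)) \<cdot> Assoc C a b c"
    and LUnit_iso: "a \<in> Obj C \<Longrightarrow> iso_arrow C (\<one> \<otimes> a) a (LUnit C a)"
    and LUnit_natural: "f \<in> Hom C a b \<Longrightarrow> LUnit C b \<cdot> (Id C \<one> \<odot> f) = f \<cdot> LUnit C a"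
    and RUnit_iso: "a \<in> Obj C \<Longrightarrow> iso_arrow C (a \<otimes> \<one>) a (RUnit C a)"
    and RUnit_natural: "f \<in> Hom C a b \<Longrightarrow> RUnit C b \<cdot> (f \<odot> Id C \<one>) = f \<cdot> RUnit C a"
    and triangle: "\<lbrakk>a \<in> Obj C; b \<in> Obj C\<rbrakk>
        \<Longrightarrow> (Id C a \<odot> LUnit C b) \<cdot> Assoc C a \<one> b = RUnit C a \<odot> Id C b"
    and pentagon: "\<lbrakk>a \<in> Obj C; b \<in> Obj C; c \<in> Obj C; d \<in> Obj C\<rbrakk>
        \<Longrightarrow> Assoc C a b (c \<otimes> d) \<cdot> Assoc C (a \<otimes> b) c d
          = (Id C a \<odot> Assoc C b c d) \<cdot> Assoc C a (b \<otimes> c) d \<cdot> (Assoc C a b c \<odot> Id C d)"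

record ('o, 'a) symmetric_monoidal_category = "('o, 'a) monoidal_category" +
  Swap :: "'o \<Rightarrow> 'o \<Rightarrow> 'a"

locale symmetric_monoidal_category = monoidal_category C
  for C :: "('o, 'a, 'z) symmetric_monoidal_category_scheme" (structure) +
  assumes Swap_Hom: "\<lbrakk>a \<in> Obj C; b \<in> Obj C\<rbrakk> \<Longrightarrow> Swap C a b \<in> Hom C (a \<otimes> b) (b \<otimes> a)"
    and Swap_Swap: "\<lbrakk>a \<in> Obj C; b \<in> Obj C\<rbrakk> \<Longrightarrow> Swap C b a \<cdot> Swap C a b = Id C (a \<otimes> b)"
    and Swap_natural: "\<lbrakk>f \<in> Hom C a a'; g \<in> Hom C b b'\<rbrakk>
        \<Longrightarrow> Swap C a' b' \<cdot> (f \<odot> g) = (g \<odot> f) \<cdot> Swap C a b"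
    and hexagon: "\<lbrakk>a \<in> Obj C; b \<in> Obj C; c \<in> Obj C\<rbrakk>
        \<Longrightarrow> Assoc C b c a \<cdot> Swap C a (b \<otimes> c) \<cdot> Assoc C a b c
          = (Id C b \<odot> Swap C a c) \<cdot> Assoc C b a c \<cdot> (Swap C a b \<odot> Id C c)"

text \<open>
  \<open>IHom C y z\<close> is the internal hom [y; z] and \<open>Eval C y z : y \<otimes> [y; z] \<rightarrow> z\<close> the evaluation. The
  bijection Hom(x; [y; z]) \<rightarrow> Hom(y \<otimes> x; z) sends g to \<open>Eval C y z \<cdot> (Id C y \<odot> g)\<close>; it is
  automatically natural in x, so \<open>IHom C y\<close> is the right adjoint of \<open>y \<otimes> -\<close> with counit
  \<open>Eval C y\<close>.
\<close>

record ('o, 'a) closed_category = "('o, 'a) symmetric_monoidal_category" +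
  IHom :: "'o \<Rightarrow> 'o \<Rightarrow> 'o"
  Eval :: "'o \<Rightarrow> 'o \<Rightarrow> 'a"

definition uncurry :: "('o, 'a, 'z) closed_category_scheme \<Rightarrow> 'o \<Rightarrow> 'o \<Rightarrow> 'a \<Rightarrow> 'a" where
  "uncurry C y z g = Eval C y z \<cdot>\<^bsub>C\<^esub> (Id C y \<odot>\<^bsub>C\<^esub> g)"

locale closed_symmetric_monoidal_category = symmetric_monoidal_category C
  for C :: "('o, 'a, 'z) closed_category_scheme" (structure) +
  assumes IHom_Obj: "\<lbrakk>y \<in> Obj C; z \<in> Obj C\<rbrakk> \<Longrightarrow> IHom C y z \<in> Obj C"
    and Eval_Hom: "\<lbrakk>y \<in> Obj C; z \<in> Obj C\<rbrakk> \<Longrightarrow> Eval C y z \<in> Hom C (y \<otimes> IHom C y z) z"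
    and uncurry_bij: "\<lbrakk>x \<in> Obj C; y \<in> Obj C; z \<in> Obj C\<rbrakk>
        \<Longrightarrow> bij_betw (uncurry C y z) (Hom C x (IHom C y z)) (Hom C (y \<otimes> x) z)"

text \<open>The adjoint \<open>x \<rightarrow> [y; z]\<close> of \<open>F : y \<otimes> x \<rightarrow> z\<close>, written \<open>F\<^sup>\<flat>\<close> on paper.\<close>

definition flat :: "('o, 'a, 'z) closed_category_scheme \<Rightarrow> 'o \<Rightarrow> 'o \<Rightarrow> 'o \<Rightarrow> 'a \<Rightarrow> 'a" where
  "flat C y x z F = the_inv_into (Hom C x (IHom C y z)) (uncurry C y z) F"


section \<open>Enriched categories, monoid objects and actions\<close>

record ('e, 'o, 'a) enriched_category =
  EObj :: "'e set"
  EHom :: "'e \<Rightarrow> 'e \<Rightarrow> 'o"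
  EComp :: "'e \<Rightarrow> 'e \<Rightarrow> 'e \<Rightarrow> 'a"
  EId :: "'e \<Rightarrow> 'a"

text \<open>\<open>EComp V p q r\<close> is the composition \<open>V(q, r) \<otimes> V(p, q) \<rightarrow> V(p, r)\<close>.\<close>

locale enriched_category = monoidal_category C
  for C :: "('o, 'a, 'z) monoidal_category_scheme" (structure)
    and V :: "('e, 'o, 'a, 'w) enriched_category_scheme" +
  assumes EHom_Obj: "\<lbrakk>p \<in> EObj V; q \<in> EObj V\<rbrakk> \<Longrightarrow> EHom V p q \<in> Obj C"
    and EComp_Hom: "\<lbrakk>p \<in> EObj V; q \<in> EObj V; r \<in> EObj V\<rbrakk>
        \<Longrightarrow> EComp V p q r \<in> Hom C (EHom V q r \<otimes> EHom V p q) (EHom V p r)"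
    and EId_Hom: "p \<in> EObj V \<Longrightarrow> EId V p \<in> Hom C \<one> (EHom V p p)"
    and EComp_assoc: "\<lbrakk>p \<in> EObj V; q \<in> EObj V; r \<in> EObj V; s \<in> EObj V\<rbrakk>
        \<Longrightarrow> EComp V p q s \<cdot> (EComp V q r s \<odot> Id C (EHom V p q))
          = EComp V p r s \<cdot> (Id C (EHom V r s) \<odot> EComp V p q r)
              \<cdot> Assoc C (EHom V r s) (EHom V q r) (EHom V p q)"
    and EComp_left_unit: "\<lbrakk>p \<in> EObj V; q \<in> EObj V\<rbrakk>
        \<Longrightarrow> EComp V p q q \<cdot> (EId V q \<odot> Id C (EHom V p q)) = LUnit C (EHom V p q)"
    and EComp_right_unit: "\<lbrakk>p \<in> EObj V; q \<in> EObj V\<rbrakk>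
        \<Longrightarrow> EComp V p p q \<cdot> (Id C (EHom V p q) \<odot> EId V p) = RUnit C (EHom V p q)"

definition monoid_object ::
    "('o, 'a, 'z) monoidal_category_scheme \<Rightarrow> 'o \<Rightarrow> 'a \<Rightarrow> 'a \<Rightarrow> bool" where
  "monoid_object C T \<mu> \<iota> \<longleftrightarrow>
     T \<in> Obj C \<and> \<mu> \<in> Hom C (T \<otimes>\<^bsub>C\<^esub> T) T \<and> \<iota> \<in> Hom C \<one>\<^bsub>C\<^esub> T \<and>
     \<mu> \<cdot>\<^bsub>C\<^esub> (\<mu> \<odot>\<^bsub>C\<^esub> Id C T) = \<mu> \<cdot>\<^bsub>C\<^esub> (Id C T \<odot>\<^bsub>C\<^esub> \<mu>) \<cdot>\<^bsub>C\<^esub> Assoc C T T T \<and>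
     \<mu> \<cdot>\<^bsub>C\<^esub> (\<iota> \<odot>\<^bsub>C\<^esub> Id C T) = LUnit C T \<and>
     \<mu> \<cdot>\<^bsub>C\<^esub> (Id C T \<odot>\<^bsub>C\<^esub> \<iota>) = RUnit C T"

definition commutative_monoid_object ::
    "('o, 'a, 'z) symmetric_monoidal_category_scheme \<Rightarrow> 'o \<Rightarrow> 'a \<Rightarrow> 'a \<Rightarrow> bool" where
  "commutative_monoid_object C T \<mu> \<iota> \<longleftrightarrow> monoid_object C T \<mu> \<iota> \<and> \<mu> \<cdot>\<^bsub>C\<^esub> Swap C T T = \<mu>"

definition left_action ::
    "('o, 'a, 'z) monoidal_category_scheme \<Rightarrow> 'o \<Rightarrow> 'a \<Rightarrow> 'a \<Rightarrow> 'o \<Rightarrow> 'a \<Rightarrow> bool" where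
  "left_action C T \<mu> \<iota> X \<Psi> \<longleftrightarrow>
     X \<in> Obj C \<and> \<Psi> \<in> Hom C (T \<otimes>\<^bsub>C\<^esub> X) X \<and>
     \<Psi> \<cdot>\<^bsub>C\<^esub> (\<iota> \<odot>\<^bsub>C\<^esub> Id C X) = LUnit C X \<and>
     \<Psi> \<cdot>\<^bsub>C\<^esub> (Id C T \<odot>\<^bsub>C\<^esub> \<Psi>) \<cdot>\<^bsub>C\<^esub> Assoc C T T X = \<Psi> \<cdot>\<^bsub>C\<^esub> (\<mu> \<odot>\<^bsub>C\<^esub> Id C X)"


section \<open>Shift and transfer operator\<close>

text \<open>
  The arrows being transposed have domain \<open>T \<otimes> (T \<otimes> [T; \<Omega>])\<close>, and the leftmost \<open>T\<close> is the one
  moved to the other side.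
\<close>

definition shift :: "('o, 'a, 'z) closed_category_scheme \<Rightarrow> 'o \<Rightarrow> 'a \<Rightarrow> 'o \<Rightarrow> 'a" where
  "shift C T \<mu> \<Omega> = (let H = IHom C T \<Omega> in
     flat C T (T \<otimes>\<^bsub>C\<^esub> H) \<Omega>
       (Eval C T \<Omega> \<cdot>\<^bsub>C\<^esub> (\<mu> \<odot>\<^bsub>C\<^esub> Id C H) \<cdot>\<^bsub>C\<^esub> Inv C (Assoc C T T H)))"

definition transfer :: "('o, 'a, 'z) closed_category_scheme \<Rightarrow> 'o \<Rightarrow> 'o \<Rightarrow> 'a \<Rightarrow> 'a" where
  "transfer C T \<Omega> \<Phi> = (let H = IHom C T \<Omega> in
     flat C T (T \<otimes>\<^bsub>C\<^esub> H) \<Omega>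
       (\<Phi> \<cdot>\<^bsub>C\<^esub> (Id C T \<odot>\<^bsub>C\<^esub> Eval C T \<Omega>) \<cdot>\<^bsub>C\<^esub> Assoc C T T H
          \<cdot>\<^bsub>C\<^esub> (Swap C T T \<odot>\<^bsub>C\<^esub> Id C H) \<cdot>\<^bsub>C\<^esub> Inv C (Assoc C T T H)))"

definition shift_flat :: "('o, 'a, 'z) closed_category_scheme \<Rightarrow> 'o \<Rightarrow> 'a \<Rightarrow> 'o \<Rightarrow> 'a" where
  "shift_flat C T \<mu> \<Omega> = flat C T (IHom C T \<Omega>) (IHom C T \<Omega>) (shift C T \<mu> \<Omega>)"

definition transfer_flat :: "('o, 'a, 'z) closed_category_scheme \<Rightarrow> 'o \<Rightarrow> 'o \<Rightarrow> 'a \<Rightarrow> 'a" where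
  "transfer_flat C T \<Omega> \<Phi> = flat C T (IHom C T \<Omega>) (IHom C T \<Omega>) (transfer C T \<Omega> \<Phi>)"

end

theory Submission
  imports Defs
begin

text \<open>
  For an arrow \<open>h : X \<rightarrow> [T; \<Omega>]\<close> write \<open>h' : T \<otimes> X \<rightarrow> \<Omega>\<close> for its adjoint. Transposing
  \<open>shift\<^sup>\<flat> \<cdot> h\<close> and \<open>Tr\<^sup>\<flat> \<cdot> h\<close> back twice, and then cancelling \<open>swap\<close> by means of
  \<open>\<mu> \<cdot> swap = \<mu>\<close>, shows that \<open>h\<close> equalizes the two arrows if and only if
  \<open>h' \<cdot> (\<mu> \<otimes> X) = \<Phi> \<cdot> (T \<otimes> h')\<close> up to the associator, that is, if and only if \<open>h'\<close> is an
  equivariant arrow from the free \<open>T\<close>-action \<open>T \<otimes> X\<close> to \<open>\<Omega>\<close>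
  (lemma \<open>shift_transfer_equalize_iff\<close>).

  The arrow \<open>\<Phi>\<^sup>\<flat>\<close> satisfies this condition, which for \<open>h' = \<Phi>\<close> is the associativity law of the
  action.
  By the universal property of the free action, an equivariant \<open>h'\<close> is determined by its restriction
  \<open>k\<close> along the unit \<open>\<iota> \<otimes> X\<close>, with \<open>h' = \<Phi> \<cdot> (T \<otimes> k)\<close> (lemma
  \<open>equivariant_eq_action_comp_restriction\<close>); the latter equation says exactly \<open>h = \<Phi>\<^sup>\<flat> \<cdot> k\<close>.
  Finally \<open>k\<close> is unique because the unit law of the action recovers \<open>k\<close> from \<open>\<Phi> \<cdot> (T \<otimes> k)\<close>.
  Hence \<open>\<Phi>\<^sup>\<flat>\<close> is an equalizer, and any two equalizers are isomorphic.
\<close>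

section \<open>Composition, inverses and equalizers in a category\<close>

text \<open>
  The category axioms are restated with \<open>Arr\<close>, \<open>Dom\<close> and \<open>Cod\<close> in place of \<open>Hom\<close>, so that
  their side conditions can be discharged by rewriting.
\<close>

lemma HomD:
  assumes "f \<in> Hom C a b"
  shows "f \<in> Arr C" "Dom C f = a" "Cod C f = b"
  using assms by (auto simp: Hom_def)

lemma HomI: "\<lbrakk>f \<in> Arr C; Dom C f = a; Cod C f = b\<rbrakk> \<Longrightarrow> f \<in> Hom C a b"
  by (auto simp: Hom_def)

context category
begin

lemma Comp_simps:
  assumes "f \<in> Arr C" "g \<in> Arr C" "Dom C g = Cod C f"
  shows "g \<cdot> f \<in> Arr C" "Dom C (g \<cdot> f) = Dom C f" "Cod C (g \<cdot> f) = Cod C g"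
  using Comp_Hom[of f "Dom C f" "Cod C f" g "Cod C g"] assms by (auto simp: Hom_def)

lemma Id_simps:
  assumes "a \<in> Obj C"
  shows "Id C a \<in> Arr C" "Dom C (Id C a) = a" "Cod C (Id C a) = a"
  using Id_Hom[OF assms] by (auto simp: Hom_def)

lemma Comp_Id_simp: "\<lbrakk>f \<in> Arr C; Dom C f = a\<rbrakk> \<Longrightarrow> f \<cdot> Id C a = f"
  using Comp_Id[of f a "Cod C f"] by (auto simp: Hom_def)

lemma Id_Comp_simp: "\<lbrakk>f \<in> Arr C; Cod C f = b\<rbrakk> \<Longrightarrow> Id C b \<cdot> f = f"
  using Id_Comp[of f "Dom C f" b] by (auto simp: Hom_def)

lemma Comp_assoc_simp:
  "\<lbrakk>f \<in> Arr C; g \<in> Arr C; h \<in> Arr C; Dom C g = Cod C f; Dom C h = Cod C g\<rbrakk>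
    \<Longrightarrow> (h \<cdot> g) \<cdot> f = h \<cdot> (g \<cdot> f)"
  using Comp_assoc[of f "Dom C f" "Cod C f" g "Cod C g" h "Cod C h"] by (auto simp: Hom_def)

lemmas cat_simps = Dom_Obj Cod_Obj Comp_simps Id_simps Comp_Id_simp Id_Comp_simp Comp_assoc_simp

lemma inverse_arrows_unique:
  assumes "inverse_arrows C a b f g" and "inverse_arrows C a b f g'"
  shows "g = g'"
proof -
  have f: "f \<in> Hom C a b" and g: "g \<in> Hom C b a" and g': "g' \<in> Hom C b a"
    and gf: "g \<cdot> f = Id C a" and fg': "f \<cdot> g' = Id C b"
    using assms by (auto simp: inverse_arrows_def)
  have "g = g \<cdot> (f \<cdot> g')"
    using Comp_Id[OF g] fg' by simp
  also have "\<dots> = (g \<cdot> f) \<cdot> g'"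
    using Comp_assoc[OF g' f g] by simp
  also have "\<dots> = g'"
    using Id_Comp[OF g'] gf by simp
  finally show ?thesis .
qed

lemma Inv_inverse_arrows:
  assumes "iso_arrow C a b f"
  shows "inverse_arrows C a b f (Inv C f)"
proof -
  obtain g where g: "inverse_arrows C a b f g"
    using assms by (auto simp: iso_arrow_def)
  hence "Dom C f = a" "Cod C f = b"
    by (auto simp: inverse_arrows_def Hom_def)
  with g show ?thesis
    unfolding Inv_def using inverse_arrows_unique by (auto intro: theI)
qed

lemma Inv_Hom: "iso_arrow C a b f \<Longrightarrow> Inv C f \<in> Hom C b a"
  and Inv_Comp: "iso_arrow C a b f \<Longrightarrow> Inv C f \<cdot> f = Id C a"
  and Comp_Inv: "iso_arrow C a b f \<Longrightarrow> f \<cdot> Inv C f = Id C b"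
  and iso_arrow_Hom: "iso_arrow C a b f \<Longrightarrow> f \<in> Hom C a b"
  using Inv_inverse_arrows[of a b f] by (auto simp: inverse_arrows_def)

lemma iso_arrow_Inv: "iso_arrow C a b f \<Longrightarrow> iso_arrow C b a (Inv C f)"
  using Inv_inverse_arrows[of a b f] by (auto simp: inverse_arrows_def iso_arrow_def)

lemma iso_arrow_cancel_right:
  assumes f: "iso_arrow C a b f" and g: "g \<in> Hom C b c" and h: "h \<in> Hom C b c"
  shows "g \<cdot> f = h \<cdot> f \<longleftrightarrow> g = h"
proof
  assume eq: "g \<cdot> f = h \<cdot> f"
  have "u = (u \<cdot> f) \<cdot> Inv C f" if "u \<in> Hom C b c" for u
    using Comp_assoc[OF Inv_Hom[OF f] iso_arrow_Hom[OF f] that] Comp_Inv[OF f] Comp_Id[OF that]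
    by simp
  with eq g h show "g = h" by metis
qed simp

lemma equalizer_factorization:
  assumes "is_equalizer C E A B e f g" and "h \<in> Hom C X A" and "f \<cdot> h = g \<cdot> h"
  obtains k where "k \<in> Hom C X E" "e \<cdot> k = h"
  using assms unfolding is_equalizer_def by blast

lemma equalizer_mono:
  assumes e: "is_equalizer C E A B e f g"
    and k: "k \<in> Hom C X E" "k' \<in> Hom C X E" and eq: "e \<cdot> k = e \<cdot> k'"
  shows "k = k'"
proof -
  have e': "e \<in> Hom C E A" "f \<in> Hom C A B" "g \<in> Hom C A B" "f \<cdot> e = g \<cdot> e"
    using e by (auto simp: is_equalizer_def)
  have "f \<cdot> (e \<cdot> k) = g \<cdot> (e \<cdot> k)"
    using Comp_assoc[OF k(1) e'(1) e'(2)] Comp_assoc[OF k(1) e'(1) e'(3)] e'(4) by simp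
  moreover have "e \<cdot> k \<in> Hom C X A"
    using Comp_Hom[OF k(1) e'(1)] .
  ultimately have "\<exists>!l. l \<in> Hom C X E \<and> e \<cdot> l = e \<cdot> k"
    using e unfolding is_equalizer_def by blast
  with k eq show ?thesis by metis
qed

lemma equalizer_unique_up_to_iso:
  assumes d: "is_equalizer C D A B d f g" and e: "is_equalizer C E A B e f g"
  obtains i where "iso_arrow C D E i" "iso_arrow C E D (Inv C i)" "e \<cdot> i = d"
proof -
  have dA: "d \<in> Hom C D A" "f \<cdot> d = g \<cdot> d" and eA: "e \<in> Hom C E A" "f \<cdot> e = g \<cdot> e"
    using d e by (auto simp: is_equalizer_def)
  have obj: "D \<in> Obj C" "E \<in> Obj C"
    using Dom_Obj dA(1) eA(1) by (auto simp: Hom_def)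
  obtain i where i: "i \<in> Hom C D E" "e \<cdot> i = d"
    using equalizer_factorization[OF e dA] .
  obtain j where j: "j \<in> Hom C E D" "d \<cdot> j = e"
    using equalizer_factorization[OF d eA] .
  have "d \<cdot> (j \<cdot> i) = d \<cdot> Id C D"
    using Comp_assoc[OF i(1) j(1) dA(1)] i j Comp_Id[OF dA(1)] by simp
  hence ji: "j \<cdot> i = Id C D"
    using equalizer_mono[OF d Comp_Hom[OF i(1) j(1)] Id_Hom] obj by blast
  have "e \<cdot> (i \<cdot> j) = e \<cdot> Id C E"
    using Comp_assoc[OF j(1) i(1) eA(1)] i j Comp_Id[OF eA(1)] by simp
  hence ij: "i \<cdot> j = Id C E"
    using equalizer_mono[OF e Comp_Hom[OF j(1) i(1)] Id_Hom] obj by blast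
  have "iso_arrow C D E i"
    using i j ij ji by (auto simp: iso_arrow_def inverse_arrows_def)
  with i(2) that iso_arrow_Inv show ?thesis by blast
qed

end

section \<open>Tensor products of arrows\<close>

context monoidal_category
begin

lemma TensorArr_simps:
  assumes "f \<in> Arr C" "g \<in> Arr C"
  shows "f \<odot> g \<in> Arr C" "Dom C (f \<odot> g) = Dom C f \<otimes> Dom C g"
    "Cod C (f \<odot> g) = Cod C f \<otimes> Cod C g"
  using TensorArr_Hom[of f "Dom C f" "Cod C f" g "Dom C g" "Cod C g"] assms
  by (auto simp: Hom_def)

lemma TensorArr_interchange:
  assumes "f \<in> Arr C" "f' \<in> Arr C" "g \<in> Arr C" "g' \<in> Arr C"
    and "Dom C f' = Cod C f" "Dom C g' = Cod C g"
  shows "(f' \<odot> g') \<cdot> (f \<odot> g) = (f' \<cdot> f) \<odot> (g' \<cdot> g)"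
  using TensorArr_Comp[of f "Dom C f" "Cod C f" f' "Cod C f'" g "Dom C g" "Cod C g" g' "Cod C g'"]
    assms by (auto simp: Hom_def)

lemma TensorArr_interchange_Comp:
  assumes "f \<in> Arr C" "f' \<in> Arr C" "g \<in> Arr C" "g' \<in> Arr C"
    and "Dom C f' = Cod C f" "Dom C g' = Cod C g"
    and "x \<in> Arr C" "Cod C x = Dom C f \<otimes> Dom C g"
  shows "(f' \<odot> g') \<cdot> ((f \<odot> g) \<cdot> x) = ((f' \<cdot> f) \<odot> (g' \<cdot> g)) \<cdot> x"
  using TensorArr_interchange[OF assms(1-6)] assms
    Comp_assoc_simp[of x "f \<odot> g" "f' \<odot> g'"]
  by (simp add: TensorArr_simps)

lemmas tensor_simps = cat_simps Unit_Obj Tensor_Obj TensorArr_simps TensorArr_Id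
  TensorArr_interchange TensorArr_interchange_Comp

lemma iso_arrow_TensorArr_Id:
  assumes "iso_arrow C a b f" and "x \<in> Obj C"
  shows "iso_arrow C (a \<otimes> x) (b \<otimes> x) (f \<odot> Id C x)"
proof -
  note f = HomD[OF iso_arrow_Hom[OF assms(1)]] and i = HomD[OF Inv_Hom[OF assms(1)]]
  have obj: "a \<in> Obj C" "b \<in> Obj C"
    using f Dom_Obj Cod_Obj by auto
  have "inverse_arrows C (a \<otimes> x) (b \<otimes> x) (f \<odot> Id C x) (Inv C f \<odot> Id C x)"
    unfolding inverse_arrows_def
    using f i obj assms(2) Inv_Comp[OF assms(1)] Comp_Inv[OF assms(1)]
    by (auto intro!: HomI simp: tensor_simps)
  thus ?thesis by (auto simp: iso_arrow_def)
qed

text \<open>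
  The naturality of the inverse associator, for an arrow in the third argument.
\<close>

lemma Inv_Assoc_natural:
  assumes a: "a \<in> Obj C" and b: "b \<in> Obj C" and h: "h \<in> Hom C c c'"
  shows "Inv C (Assoc C a b c') \<cdot> (Id C a \<odot> (Id C b \<odot> h))
    = (Id C (a \<otimes> b) \<odot> h) \<cdot> Inv C (Assoc C a b c)"
proof -
  note hs = HomD[OF h]
  have obj: "c \<in> Obj C" "c' \<in> Obj C"
    using hs Dom_Obj Cod_Obj by auto
  note iso = Assoc_iso[OF a b obj(1)] and iso' = Assoc_iso[OF a b obj(2)]
  note A = HomD[OF iso_arrow_Hom[OF iso]] HomD[OF iso_arrow_Hom[OF iso']]
    HomD[OF Inv_Hom[OF iso]] HomD[OF Inv_Hom[OF iso']]
  let ?t = "Id C a \<odot> (Id C b \<odot> h)" and ?s = "Id C (a \<otimes> b) \<odot> h"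
  have nat: "Assoc C a b c' \<cdot> ?s = ?t \<cdot> Assoc C a b c"
    using Assoc_natural[OF Id_Hom[OF a] Id_Hom[OF b] h] a b by (simp add: TensorArr_Id)
  have st: "?t \<in> Hom C (a \<otimes> b \<otimes> c) (a \<otimes> b \<otimes> c')" "?s \<in> Hom C ((a \<otimes> b) \<otimes> c) ((a \<otimes> b) \<otimes> c')"
    using a b hs by (auto intro!: HomI simp: tensor_simps)
  note s = HomD[OF st(1)] HomD[OF st(2)]
  have "Inv C (Assoc C a b c') \<cdot> ?t
      = Inv C (Assoc C a b c') \<cdot> (?t \<cdot> (Assoc C a b c \<cdot> Inv C (Assoc C a b c)))"
    using Comp_Inv[OF iso] Comp_Id[OF st(1)] by simp
  also have "\<dots> = Inv C (Assoc C a b c') \<cdot> ((?t \<cdot> Assoc C a b c) \<cdot> Inv C (Assoc C a b c))"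
    using A s by (simp add: cat_simps)
  also have "\<dots> = (Inv C (Assoc C a b c') \<cdot> Assoc C a b c') \<cdot> (?s \<cdot> Inv C (Assoc C a b c))"
    unfolding nat[symmetric] using A s by (simp add: cat_simps)
  also have "\<dots> = ?s \<cdot> Inv C (Assoc C a b c)"
    unfolding Inv_Comp[OF iso'] using A s by (simp add: cat_simps)
  finally show ?thesis .
qed

end

section \<open>Free actions\<close>

text \<open>
  An arrow \<open>u : T \<otimes> X \<rightarrow> \<Omega>\<close> is equivariant if it commutes with the free action of \<open>T\<close> on
  \<open>T \<otimes> X\<close> and the action \<open>\<Phi>\<close> on \<open>\<Omega>\<close>. The free action is
  \<open>\<mu> \<otimes> X\<close> preceded by the inverse associator; here the associator is moved to the other side
  of the equation, so both sides have domain \<open>(T \<otimes> T) \<otimes> X\<close>.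
\<close>

definition equivariant_from_free ::
    "('o, 'a, 'z) monoidal_category_scheme \<Rightarrow> 'o \<Rightarrow> 'a \<Rightarrow> 'o \<Rightarrow> 'a \<Rightarrow> 'a \<Rightarrow> bool" where
  "equivariant_from_free C T \<mu> X \<Phi> u \<longleftrightarrow>
     u \<cdot>\<^bsub>C\<^esub> (\<mu> \<odot>\<^bsub>C\<^esub> Id C X) = \<Phi> \<cdot>\<^bsub>C\<^esub> (Id C T \<odot>\<^bsub>C\<^esub> u) \<cdot>\<^bsub>C\<^esub> Assoc C T T X"

context monoidal_category
begin

text \<open>The unit law of an action makes \<open>k \<mapsto> \<Phi> \<cdot> (T \<otimes> k)\<close> injective.\<close>

lemma action_comp_unit:
  assumes \<Phi>: "left_action C T \<mu> \<iota> \<Omega> \<Phi>" and \<iota>: "\<iota> \<in> Hom C \<one> T" and k: "k \<in> Hom C X \<Omega>"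
  shows "(\<Phi> \<cdot> (Id C T \<odot> k)) \<cdot> (\<iota> \<odot> Id C X) = k \<cdot> LUnit C X"
proof -
  note ks = HomD[OF k] and \<iota>s = HomD[OF \<iota>]
  have \<Phi>H: "\<Phi> \<in> Hom C (T \<otimes> \<Omega>) \<Omega>" and unit: "\<Phi> \<cdot> (\<iota> \<odot> Id C \<Omega>) = LUnit C \<Omega>"
    using \<Phi> by (auto simp: left_action_def)
  note \<Phi>s = HomD[OF \<Phi>H]
  have obj: "T \<in> Obj C" "X \<in> Obj C" "\<Omega> \<in> Obj C"
    using ks \<iota>s Dom_Obj Cod_Obj by auto
  have "(\<Phi> \<cdot> (Id C T \<odot> k)) \<cdot> (\<iota> \<odot> Id C X) = (\<Phi> \<cdot> (\<iota> \<odot> Id C \<Omega>)) \<cdot> (Id C \<one> \<odot> k)"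
    using ks \<iota>s \<Phi>s obj by (simp add: tensor_simps)
  also have "\<dots> = k \<cdot> LUnit C X"
    unfolding unit by (rule LUnit_natural[OF k])
  finally show ?thesis .
qed

text \<open>
  An equivariant arrow out of a free action is recovered from its restriction along the unit.
  Equivariance turns the left side into \<open>u\<close> after multiplication by the unit on the right, which
  is trivial by the right unit law of the monoid; of \<open>\<Phi>\<close>, only its domain and codomain matter.
\<close>

lemma equivariant_eq_action_comp_restriction:
  assumes mon: "monoid_object C T \<mu> \<iota>" and \<Phi>: "\<Phi> \<in> Hom C (T \<otimes> \<Omega>) \<Omega>"
    and X: "X \<in> Obj C" and u: "u \<in> Hom C (T \<otimes> X) \<Omega>"
    and equi: "equivariant_from_free C T \<mu> X \<Phi> u"
  shows "\<Phi> \<cdot> (Id C T \<odot> (u \<cdot> (\<iota> \<odot> Id C X) \<cdot> Inv C (LUnit C X))) = u"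
proof -
  have T: "T \<in> Obj C" and \<mu>: "\<mu> \<in> Hom C (T \<otimes> T) T" and \<iota>: "\<iota> \<in> Hom C \<one> T"
    and runit: "\<mu> \<cdot> (Id C T \<odot> \<iota>) = RUnit C T"
    using mon by (auto simp: monoid_object_def)
  note L = LUnit_iso[OF X] and A1 = Assoc_iso[OF T Unit_Obj X] and A = Assoc_iso[OF T T X]
  note hs = HomD[OF \<mu>] HomD[OF \<iota>] HomD[OF u] HomD[OF \<Phi>] HomD[OF iso_arrow_Hom[OF L]]
    HomD[OF Inv_Hom[OF L]] HomD[OF iso_arrow_Hom[OF A1]] HomD[OF Inv_Hom[OF A1]]
    HomD[OF iso_arrow_Hom[OF A]]
  let ?L = "LUnit C X" and ?A1 = "Assoc C T \<one> X" and ?A = "Assoc C T T X"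
  have assoc_nat: "?A \<cdot> ((Id C T \<odot> \<iota>) \<odot> Id C X) = (Id C T \<odot> (\<iota> \<odot> Id C X)) \<cdot> ?A1"
    using Assoc_natural[OF Id_Hom[OF T] \<iota> Id_Hom[OF X]] .
  \<comment> \<open>The arrow composed on the right is \<open>RUnit C T \<odot> Id C X\<close> by the triangle identity, hence it is
    invertible and can be cancelled at the end.\<close>
  have "(\<Phi> \<cdot> (Id C T \<odot> (u \<cdot> (\<iota> \<odot> Id C X) \<cdot> Inv C ?L))) \<cdot> ((Id C T \<odot> ?L) \<cdot> ?A1)
      = \<Phi> \<cdot> (Id C T \<odot> (u \<cdot> (\<iota> \<odot> Id C X) \<cdot> (Inv C ?L \<cdot> ?L))) \<cdot> ?A1"
    using hs T X by (simp add: tensor_simps)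
  also have "\<dots> = (\<Phi> \<cdot> (Id C T \<odot> u)) \<cdot> ((Id C T \<odot> (\<iota> \<odot> Id C X)) \<cdot> ?A1)"
    unfolding Inv_Comp[OF L] using hs T X by (simp add: tensor_simps)
  also have "\<dots> = (\<Phi> \<cdot> (Id C T \<odot> u) \<cdot> ?A) \<cdot> ((Id C T \<odot> \<iota>) \<odot> Id C X)"
    unfolding assoc_nat[symmetric] using hs T X by (simp add: tensor_simps)
  also have "\<dots> = (u \<cdot> (\<mu> \<odot> Id C X)) \<cdot> ((Id C T \<odot> \<iota>) \<odot> Id C X)"
    using equi by (simp add: equivariant_from_free_def)
  also have "\<dots> = u \<cdot> (RUnit C T \<odot> Id C X)"
    using hs T X runit by (simp add: tensor_simps)
  also have "\<dots> = u \<cdot> ((Id C T \<odot> ?L) \<cdot> ?A1)"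
    using triangle[OF T X] by simp
  finally have eq: "(\<Phi> \<cdot> (Id C T \<odot> (u \<cdot> (\<iota> \<odot> Id C X) \<cdot> Inv C ?L))) \<cdot> ((Id C T \<odot> ?L) \<cdot> ?A1)
      = u \<cdot> ((Id C T \<odot> ?L) \<cdot> ?A1)" .
  have iso: "iso_arrow C ((T \<otimes> \<one>) \<otimes> X) (T \<otimes> X) ((Id C T \<odot> ?L) \<cdot> ?A1)"
    unfolding triangle[OF T X] by (rule iso_arrow_TensorArr_Id[OF RUnit_iso[OF T] X])
  have "\<Phi> \<cdot> (Id C T \<odot> (u \<cdot> (\<iota> \<odot> Id C X) \<cdot> Inv C ?L)) \<in> Hom C (T \<otimes> X) \<Omega>"
    using hs T X by (auto intro!: HomI simp: tensor_simps)
  from iso_arrow_cancel_right[OF iso this u] eq show ?thesis by blast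
qed

end

section \<open>Transposition\<close>

context closed_symmetric_monoidal_category
begin

lemma uncurry_Hom:
  assumes "g \<in> Hom C x (IHom C y z)" and "y \<in> Obj C" "z \<in> Obj C"
  shows "uncurry C y z g \<in> Hom C (y \<otimes> x) z"
  using uncurry_bij[of x y z] assms Dom_Obj[of g] by (auto simp: Hom_def bij_betw_def)

lemma uncurry_inject:
  assumes "g \<in> Hom C x (IHom C y z)" "h \<in> Hom C x (IHom C y z)" and "y \<in> Obj C" "z \<in> Obj C"
  shows "uncurry C y z g = uncurry C y z h \<longleftrightarrow> g = h"
proof -
  have "x \<in> Obj C"
    using assms(1) Dom_Obj by (auto simp: Hom_def)
  thus ?thesis
    using uncurry_bij[of x y z] assms unfolding bij_betw_def by (meson inj_on_eq_iff)
qed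

lemma flat_Hom:
  assumes "F \<in> Hom C (y \<otimes> x) z" and "x \<in> Obj C" "y \<in> Obj C" "z \<in> Obj C"
  shows "flat C y x z F \<in> Hom C x (IHom C y z)"
  unfolding flat_def using uncurry_bij[OF assms(2-4)] assms(1)
  by (auto simp: bij_betw_def intro!: the_inv_into_into)

lemma uncurry_flat:
  assumes "F \<in> Hom C (y \<otimes> x) z" and "x \<in> Obj C" "y \<in> Obj C" "z \<in> Obj C"
  shows "uncurry C y z (flat C y x z F) = F"
  unfolding flat_def using uncurry_bij[OF assms(2-4)] assms(1)
  by (simp add: f_the_inv_into_f_bij_betw)

lemma uncurry_Comp:
  assumes "g \<in> Hom C x (IHom C y z)" "h \<in> Hom C w x" and "y \<in> Obj C" "z \<in> Obj C"
  shows "uncurry C y z (g \<cdot> h) = uncurry C y z g \<cdot> (Id C y \<odot> h)"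
  using HomD[OF assms(1)] HomD[OF assms(2)] assms(3,4) IHom_Obj[OF assms(3,4)]
    HomD[OF Eval_Hom[OF assms(3,4)]]
  by (simp add: uncurry_def tensor_simps)

text \<open>
  Precomposing a twice transposed arrow with \<open>h\<close> amounts to precomposing the original arrow with
  \<open>h\<close> in its last tensor factor. Both \<open>shift\<^sup>\<flat>\<close> and \<open>Tr\<^sup>\<flat>\<close> are such transposes.
\<close>

lemma uncurry_uncurry_flat_flat_Comp:
  assumes G: "G \<in> Hom C (y \<otimes> y' \<otimes> x) z" and h: "h \<in> Hom C w x"
    and y: "y \<in> Obj C" and y': "y' \<in> Obj C" and z: "z \<in> Obj C"
  shows "uncurry C y z (uncurry C y' (IHom C y z)
        (flat C y' x (IHom C y z) (flat C y (y' \<otimes> x) z G) \<cdot> h))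
    = G \<cdot> (Id C y \<odot> (Id C y' \<odot> h))"
proof -
  have x: "x \<in> Obj C"
    using h Cod_Obj by (auto simp: Hom_def)
  have F: "flat C y (y' \<otimes> x) z G \<in> Hom C (y' \<otimes> x) (IHom C y z)"
    using flat_Hom[OF G _ y z] Tensor_Obj[OF y' x] by blast
  have "uncurry C y' (IHom C y z) (flat C y' x (IHom C y z) (flat C y (y' \<otimes> x) z G) \<cdot> h)
      = flat C y (y' \<otimes> x) z G \<cdot> (Id C y' \<odot> h)"
    using uncurry_Comp[OF flat_Hom[OF F x y' IHom_Obj[OF y z]] h y' IHom_Obj[OF y z]]
      uncurry_flat[OF F x y' IHom_Obj[OF y z]] by simp
  thus ?thesis
    using uncurry_Comp[OF F TensorArr_Hom[OF Id_Hom[OF y'] h] y z]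
      uncurry_flat[OF G Tensor_Obj[OF y' x] y z] by simp
qed

section \<open>The equalizer of shift and transfer operator\<close>

lemma shift_transpose_Hom:
  assumes "T \<in> Obj C" "\<Omega> \<in> Obj C" and "\<mu> \<in> Hom C (T \<otimes> T) T"
  shows "Eval C T \<Omega> \<cdot> (\<mu> \<odot> Id C (IHom C T \<Omega>)) \<cdot> Inv C (Assoc C T T (IHom C T \<Omega>))
    \<in> Hom C (T \<otimes> T \<otimes> IHom C T \<Omega>) \<Omega>"
  using assms HomD[OF assms(3)] IHom_Obj[OF assms(1,2)] HomD[OF Eval_Hom[OF assms(1,2)]]
    HomD[OF Inv_Hom[OF Assoc_iso[OF assms(1,1) IHom_Obj[OF assms(1,2)]]]]
  by (auto intro!: HomI simp: tensor_simps)

lemma transfer_transpose_Hom: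
  assumes "T \<in> Obj C" "\<Omega> \<in> Obj C" and "\<Phi> \<in> Hom C (T \<otimes> \<Omega>) \<Omega>"
  shows "\<Phi> \<cdot> (Id C T \<odot> Eval C T \<Omega>) \<cdot> Assoc C T T (IHom C T \<Omega>)
      \<cdot> (Swap C T T \<odot> Id C (IHom C T \<Omega>)) \<cdot> Inv C (Assoc C T T (IHom C T \<Omega>))
    \<in> Hom C (T \<otimes> T \<otimes> IHom C T \<Omega>) \<Omega>"
  using assms HomD[OF assms(3)] IHom_Obj[OF assms(1,2)] HomD[OF Eval_Hom[OF assms(1,2)]]
    HomD[OF Swap_Hom[OF assms(1,1)]]
    HomD[OF iso_arrow_Hom[OF Assoc_iso[OF assms(1,1) IHom_Obj[OF assms(1,2)]]]]
    HomD[OF Inv_Hom[OF Assoc_iso[OF assms(1,1) IHom_Obj[OF assms(1,2)]]]]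
  by (auto intro!: HomI simp: tensor_simps)

lemma shift_flat_Hom:
  assumes "T \<in> Obj C" "\<Omega> \<in> Obj C" and "\<mu> \<in> Hom C (T \<otimes> T) T"
  shows "shift_flat C T \<mu> \<Omega> \<in> Hom C (IHom C T \<Omega>) (IHom C T (IHom C T \<Omega>))"
  unfolding shift_flat_def shift_def Let_def
  using assms by (intro flat_Hom shift_transpose_Hom IHom_Obj Tensor_Obj)

lemma transfer_flat_Hom:
  assumes "T \<in> Obj C" "\<Omega> \<in> Obj C" and "\<Phi> \<in> Hom C (T \<otimes> \<Omega>) \<Omega>"
  shows "transfer_flat C T \<Omega> \<Phi> \<in> Hom C (IHom C T \<Omega>) (IHom C T (IHom C T \<Omega>))"
  unfolding transfer_flat_def transfer_def Let_def
  using assms by (intro flat_Hom transfer_transpose_Hom IHom_Obj Tensor_Obj)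

lemma uncurry_uncurry_shift_flat_Comp:
  assumes T: "T \<in> Obj C" and \<Omega>: "\<Omega> \<in> Obj C" and \<mu>: "\<mu> \<in> Hom C (T \<otimes> T) T"
    and h: "h \<in> Hom C X (IHom C T \<Omega>)"
  shows "uncurry C T \<Omega> (uncurry C T (IHom C T \<Omega>) (shift_flat C T \<mu> \<Omega> \<cdot> h))
    = (uncurry C T \<Omega> h \<cdot> (\<mu> \<odot> Id C X)) \<cdot> Inv C (Assoc C T T X)"
proof -
  let ?H = "IHom C T \<Omega>"
  have H: "?H \<in> Obj C" and X: "X \<in> Obj C"
    using IHom_Obj[OF T \<Omega>] h Dom_Obj by (auto simp: Hom_def)
  note hs = HomD[OF \<mu>] HomD[OF h] HomD[OF Eval_Hom[OF T \<Omega>]]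
    HomD[OF Inv_Hom[OF Assoc_iso[OF T T X]]] HomD[OF Inv_Hom[OF Assoc_iso[OF T T H]]]
  have "uncurry C T \<Omega> (uncurry C T ?H (shift_flat C T \<mu> \<Omega> \<cdot> h))
      = (Eval C T \<Omega> \<cdot> (\<mu> \<odot> Id C ?H) \<cdot> Inv C (Assoc C T T ?H)) \<cdot> (Id C T \<odot> (Id C T \<odot> h))"
    unfolding shift_flat_def shift_def Let_def
    by (rule uncurry_uncurry_flat_flat_Comp[OF shift_transpose_Hom[OF T \<Omega> \<mu>] h T T \<Omega>])
  also have "\<dots> = Eval C T \<Omega> \<cdot> (\<mu> \<odot> Id C ?H)
      \<cdot> (Inv C (Assoc C T T ?H) \<cdot> (Id C T \<odot> (Id C T \<odot> h)))"
    using hs T H X by (simp add: tensor_simps)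
  also have "\<dots> = (uncurry C T \<Omega> h \<cdot> (\<mu> \<odot> Id C X)) \<cdot> Inv C (Assoc C T T X)"
    unfolding Inv_Assoc_natural[OF T T h] uncurry_def
    using hs T H X by (simp add: tensor_simps)
  finally show ?thesis .
qed

lemma uncurry_uncurry_transfer_flat_Comp:
  assumes T: "T \<in> Obj C" and \<Omega>: "\<Omega> \<in> Obj C" and \<Phi>: "\<Phi> \<in> Hom C (T \<otimes> \<Omega>) \<Omega>"
    and h: "h \<in> Hom C X (IHom C T \<Omega>)"
  shows "uncurry C T \<Omega> (uncurry C T (IHom C T \<Omega>) (transfer_flat C T \<Omega> \<Phi> \<cdot> h))
    = ((\<Phi> \<cdot> (Id C T \<odot> uncurry C T \<Omega> h) \<cdot> Assoc C T T X) \<cdot> (Swap C T T \<odot> Id C X))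
        \<cdot> Inv C (Assoc C T T X)"
proof -
  let ?H = "IHom C T \<Omega>"
  have H: "?H \<in> Obj C" and X: "X \<in> Obj C"
    using IHom_Obj[OF T \<Omega>] h Dom_Obj by (auto simp: Hom_def)
  note AX = Assoc_iso[OF T T X] and AH = Assoc_iso[OF T T H]
  note hs = HomD[OF \<Phi>] HomD[OF h] HomD[OF Eval_Hom[OF T \<Omega>]] HomD[OF Swap_Hom[OF T T]]
    HomD[OF Inv_Hom[OF AX]] HomD[OF Inv_Hom[OF AH]]
    HomD[OF iso_arrow_Hom[OF AX]] HomD[OF iso_arrow_Hom[OF AH]]
  have assoc_nat: "Assoc C T T ?H \<cdot> (Id C (T \<otimes> T) \<odot> h)
      = (Id C T \<odot> (Id C T \<odot> h)) \<cdot> Assoc C T T X"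
    using Assoc_natural[OF Id_Hom[OF T] Id_Hom[OF T] h] T by (simp add: TensorArr_Id)
  have "uncurry C T \<Omega> (uncurry C T ?H (transfer_flat C T \<Omega> \<Phi> \<cdot> h))
      = (\<Phi> \<cdot> (Id C T \<odot> Eval C T \<Omega>) \<cdot> Assoc C T T ?H \<cdot> (Swap C T T \<odot> Id C ?H)
          \<cdot> Inv C (Assoc C T T ?H)) \<cdot> (Id C T \<odot> (Id C T \<odot> h))"
    unfolding transfer_flat_def transfer_def Let_def
    by (rule uncurry_uncurry_flat_flat_Comp[OF transfer_transpose_Hom[OF T \<Omega> \<Phi>] h T T \<Omega>])
  also have "\<dots> = \<Phi> \<cdot> (Id C T \<odot> Eval C T \<Omega>) \<cdot> Assoc C T T ?H \<cdot> (Swap C T T \<odot> Id C ?H)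
      \<cdot> (Inv C (Assoc C T T ?H) \<cdot> (Id C T \<odot> (Id C T \<odot> h)))"
    using hs T H X by (simp add: tensor_simps)
  also have "\<dots> = \<Phi> \<cdot> (Id C T \<odot> Eval C T \<Omega>) \<cdot> (Assoc C T T ?H \<cdot> (Id C (T \<otimes> T) \<odot> h))
      \<cdot> (Swap C T T \<odot> Id C X) \<cdot> Inv C (Assoc C T T X)"
    unfolding Inv_Assoc_natural[OF T T h]
    using hs T H X by (simp add: tensor_simps)
  also have "\<dots> = ((\<Phi> \<cdot> (Id C T \<odot> uncurry C T \<Omega> h) \<cdot> Assoc C T T X)
      \<cdot> (Swap C T T \<odot> Id C X)) \<cdot> Inv C (Assoc C T T X)"
    unfolding assoc_nat uncurry_def
    using hs T H X by (simp add: tensor_simps)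
  finally show ?thesis .
qed

text \<open>
  Transposing twice is injective, and the inverse associator is then cancelled on both sides. What
  remains is the equivariance law with \<open>swap\<close> inserted on the side of \<open>\<Phi>\<close>; commutativity of
  \<open>\<mu>\<close> inserts it on the other side as well, where it can be cancelled.
\<close>

lemma shift_transfer_equalize_iff:
  assumes T: "T \<in> Obj C" and \<Omega>: "\<Omega> \<in> Obj C"
    and \<mu>: "\<mu> \<in> Hom C (T \<otimes> T) T" and comm: "\<mu> \<cdot> Swap C T T = \<mu>"
    and \<Phi>: "\<Phi> \<in> Hom C (T \<otimes> \<Omega>) \<Omega>" and h: "h \<in> Hom C X (IHom C T \<Omega>)"
  shows "shift_flat C T \<mu> \<Omega> \<cdot> h = transfer_flat C T \<Omega> \<Phi> \<cdot> h
    \<longleftrightarrow> equivariant_from_free C T \<mu> X \<Phi> (uncurry C T \<Omega> h)"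
proof -
  let ?H = "IHom C T \<Omega>" and ?S = "Swap C T T \<odot> Id C X" and ?u = "uncurry C T \<Omega> h"
  let ?a = "?u \<cdot> (\<mu> \<odot> Id C X)" and ?b = "\<Phi> \<cdot> (Id C T \<odot> ?u) \<cdot> Assoc C T T X"
  have H: "?H \<in> Obj C" and X: "X \<in> Obj C"
    using IHom_Obj[OF T \<Omega>] h Dom_Obj by (auto simp: Hom_def)
  note u = HomD[OF uncurry_Hom[OF h T \<Omega>]]
  note A = Assoc_iso[OF T T X]
  note hs = HomD[OF \<mu>] HomD[OF \<Phi>] HomD[OF iso_arrow_Hom[OF A]] HomD[OF Swap_Hom[OF T T]]
  have a: "?a \<in> Hom C ((T \<otimes> T) \<otimes> X) \<Omega>" and b: "?b \<in> Hom C ((T \<otimes> T) \<otimes> X) \<Omega>"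
    and bS: "?b \<cdot> ?S \<in> Hom C ((T \<otimes> T) \<otimes> X) \<Omega>"
    using hs u T X by (auto intro!: HomI simp: tensor_simps)
  have "iso_arrow C (T \<otimes> T) (T \<otimes> T) (Swap C T T)"
    using Swap_Hom[OF T T] Swap_Swap[OF T T] by (auto simp: iso_arrow_def inverse_arrows_def)
  hence S: "iso_arrow C ((T \<otimes> T) \<otimes> X) ((T \<otimes> T) \<otimes> X) ?S"
    using iso_arrow_TensorArr_Id X by blast
  have aS: "?a = ?a \<cdot> ?S"
    using hs u T X comm by (simp add: tensor_simps)
  let ?s = "shift_flat C T \<mu> \<Omega> \<cdot> h" and ?t = "transfer_flat C T \<Omega> \<Phi> \<cdot> h"
  have s: "?s \<in> Hom C X (IHom C T ?H)" and t: "?t \<in> Hom C X (IHom C T ?H)"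
    using Comp_Hom[OF h] shift_flat_Hom[OF T \<Omega> \<mu>] transfer_flat_Hom[OF T \<Omega> \<Phi>] by auto
  have "?s = ?t \<longleftrightarrow> uncurry C T \<Omega> (uncurry C T ?H ?s) = uncurry C T \<Omega> (uncurry C T ?H ?t)"
    using uncurry_inject[OF uncurry_Hom[OF s T H] uncurry_Hom[OF t T H] T \<Omega>]
      uncurry_inject[OF s t T H] by simp
  also have "\<dots> \<longleftrightarrow> ?a \<cdot> Inv C (Assoc C T T X) = (?b \<cdot> ?S) \<cdot> Inv C (Assoc C T T X)"
    unfolding uncurry_uncurry_shift_flat_Comp[OF T \<Omega> \<mu> h]
      uncurry_uncurry_transfer_flat_Comp[OF T \<Omega> \<Phi> h] ..
  also have "\<dots> \<longleftrightarrow> ?a = ?b \<cdot> ?S"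
    by (rule iso_arrow_cancel_right[OF iso_arrow_Inv[OF A] a bS])
  also have "\<dots> \<longleftrightarrow> ?a \<cdot> ?S = ?b \<cdot> ?S"
    using aS by simp
  also have "\<dots> \<longleftrightarrow> ?a = ?b"
    by (rule iso_arrow_cancel_right[OF S a b])
  finally show ?thesis
    by (simp add: equivariant_from_free_def)
qed

theorem flat_action_is_equalizer:
  assumes mon: "commutative_monoid_object C T \<mu> \<iota>" and act: "left_action C T \<mu> \<iota> \<Omega> \<Phi>"
  shows "is_equalizer C \<Omega> (IHom C T \<Omega>) (IHom C T (IHom C T \<Omega>))
    (flat C T \<Omega> \<Omega> \<Phi>) (shift_flat C T \<mu> \<Omega>) (transfer_flat C T \<Omega> \<Phi>)"
proof -
  have mon': "monoid_object C T \<mu> \<iota>" and T: "T \<in> Obj C" and \<mu>: "\<mu> \<in> Hom C (T \<otimes> T) T"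
    and \<iota>: "\<iota> \<in> Hom C \<one> T" and comm: "\<mu> \<cdot> Swap C T T = \<mu>"
    using mon by (auto simp: commutative_monoid_object_def monoid_object_def)
  have \<Omega>: "\<Omega> \<in> Obj C" and \<Phi>: "\<Phi> \<in> Hom C (T \<otimes> \<Omega>) \<Omega>"
    and assoc: "\<Phi> \<cdot> (Id C T \<odot> \<Phi>) \<cdot> Assoc C T T \<Omega> = \<Phi> \<cdot> (\<mu> \<odot> Id C \<Omega>)"
    using act by (auto simp: left_action_def)
  note iff = shift_transfer_equalize_iff[OF T \<Omega> \<mu> comm \<Phi>]
  let ?e = "flat C T \<Omega> \<Omega> \<Phi>" and ?s = "shift_flat C T \<mu> \<Omega>" and ?t = "transfer_flat C T \<Omega> \<Phi>"
  have e: "?e \<in> Hom C \<Omega> (IHom C T \<Omega>)" and ue: "uncurry C T \<Omega> ?e = \<Phi>"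
    using flat_Hom[OF \<Phi> \<Omega> T \<Omega>] uncurry_flat[OF \<Phi> \<Omega> T \<Omega>] by auto
  have "?s \<cdot> ?e = ?t \<cdot> ?e"
    unfolding iff[OF e] ue equivariant_from_free_def assoc ..
  moreover have "\<exists>!k. k \<in> Hom C X \<Omega> \<and> ?e \<cdot> k = h"
    if h: "h \<in> Hom C X (IHom C T \<Omega>)" and eq: "?s \<cdot> h = ?t \<cdot> h" for X h
  proof -
    have X: "X \<in> Obj C"
      using h Dom_Obj by (auto simp: Hom_def)
    let ?u = "uncurry C T \<Omega> h"
    note u = uncurry_Hom[OF h T \<Omega>] and L = LUnit_iso[OF X]
    have factor_iff: "?e \<cdot> k = h \<longleftrightarrow> \<Phi> \<cdot> (Id C T \<odot> k) = ?u" if k: "k \<in> Hom C X \<Omega>" for k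
      using uncurry_inject[OF Comp_Hom[OF k e] h T \<Omega>] uncurry_Comp[OF e k T \<Omega>] ue by simp
    \<comment> \<open>the restriction of \<open>?u\<close> along the unit \<open>X \<cong> \<one> \<otimes> X \<rightarrow> T \<otimes> X\<close>\<close>
    let ?k = "?u \<cdot> (\<iota> \<odot> Id C X) \<cdot> Inv C (LUnit C X)"
    have k: "?k \<in> Hom C X \<Omega>"
      using Comp_Hom[OF Comp_Hom[OF Inv_Hom[OF L] TensorArr_Hom[OF \<iota> Id_Hom[OF X]]] u] .
    have "equivariant_from_free C T \<mu> X \<Phi> ?u"
      using eq iff[OF h] by blast
    hence "?e \<cdot> ?k = h"
      using equivariant_eq_action_comp_restriction[OF mon' \<Phi> X u] factor_iff[OF k] by blast
    moreover have "l = l'"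
      if l: "l \<in> Hom C X \<Omega>" "?e \<cdot> l = h" and l': "l' \<in> Hom C X \<Omega>" "?e \<cdot> l' = h" for l l'
    proof -
      have "l \<cdot> LUnit C X = l' \<cdot> LUnit C X"
        using action_comp_unit[OF act \<iota> l(1)] action_comp_unit[OF act \<iota> l'(1)]
          factor_iff[OF l(1)] factor_iff[OF l'(1)] l(2) l'(2) by simp
      thus ?thesis
        using iso_arrow_cancel_right[OF L l(1) l'(1)] by blast
    qed
    ultimately show ?thesis using k by blast
  qed
  ultimately show ?thesis
    unfolding is_equalizer_def
    using e shift_flat_Hom[OF T \<Omega> \<mu>] transfer_flat_Hom[OF T \<Omega> \<Phi>] by blast
qed

end

theorem theorem7:
  fixes C :: "('o, 'a, 'z) closed_category_scheme"
    and V :: "('e, 'o, 'a, 'w) enriched_category_scheme"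
    and pt :: 'e and T \<Omega> :: 'o and \<mu> \<iota> \<Phi> :: 'a
  assumes "closed_symmetric_monoidal_category C"
    and "enriched_category C V"
    and "EObj V = {pt}"
    and "T = EHom V pt pt" and "\<mu> = EComp V pt pt pt" and "\<iota> = EId V pt"
    and "commutative_monoid_object C T \<mu> \<iota>"
    and "left_action C T \<mu> \<iota> \<Omega> \<Phi>"
  shows "is_equalizer C \<Omega> (IHom C T \<Omega>) (IHom C T (IHom C T \<Omega>))
           (flat C T \<Omega> \<Omega> \<Phi>) (shift_flat C T \<mu> \<Omega>) (transfer_flat C T \<Omega> \<Phi>)
       \<and> (\<forall>E q. is_equalizer C E (IHom C T \<Omega>) (IHom C T (IHom C T \<Omega>))
                  q (shift_flat C T \<mu> \<Omega>) (transfer_flat C T \<Omega> \<Phi>)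
            \<longrightarrow> (\<exists>i. iso_arrow C \<Omega> E i \<and> q \<cdot>\<^bsub>C\<^esub> i = flat C T \<Omega> \<Omega> \<Phi>)
                \<and> isomorphic_objects C E \<Omega>)"
proof -
  interpret closed_symmetric_monoidal_category C by fact
  let ?A = "IHom C T \<Omega>" and ?s = "shift_flat C T \<mu> \<Omega>" and ?t = "transfer_flat C T \<Omega> \<Phi>"
  have eq: "is_equalizer C \<Omega> ?A (IHom C T ?A) (flat C T \<Omega> \<Omega> \<Phi>) ?s ?t"
    using assms(7,8) by (rule flat_action_is_equalizer)
  moreover have "(\<exists>i. iso_arrow C \<Omega> E i \<and> q \<cdot>\<^bsub>C\<^esub> i = flat C T \<Omega> \<Omega> \<Phi>) \<and> isomorphic_objects C E \<Omega>"
    if "is_equalizer C E ?A (IHom C T ?A) q ?s ?t" for E q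
    using equalizer_unique_up_to_iso[OF eq that] unfolding isomorphic_objects_def by metis
  ultimately show ?thesis by blast
qed

end
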